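(* Let $\tau$ be an infinite cardinal. If $P$ and $K$ are closed subsets of the Cantor cube $D^\tau$, both of weight $<\tau$, then every (surjective) homeomorphism between $P$ and $K$ can be extended to a homeomorphism of $D^\tau$ onto itself.
   Context: $D=\{0,1\}$ is the two-point discrete space and $D^\tau$ is the product of $\tau$ copies of $D$ with the product topology. The weight of a space is the least cardinality of a base of its topology; $P$ and $K$ carry the subspace topology. *)

theory Defs
  imports "HOL-Analysis.Analysis"
begin

unbundle cardinal_syntax

definition base_of :: "'a topology \<Rightarrow> 'a set set \<Rightarrow> bool" where
  "base_of X \<B> \<longleftrightarrow> openin X = arbitrary union_of (\<lambda>U. U \<in> \<B>)"

text \<open>
  Cardinals are well-orders that are least on their field; the weight, the least of the
  cardinalities of the bases, is therefore determined only up to the equivalence \<open>=o\<close>,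
  and the choice below picks a representative. No \<open>\<aleph>\<^sub>0\<close> is added, so a finite space
  may have finite weight.
\<close>

definition weight :: "'a topology \<Rightarrow> 'a set rel" where
  "weight X = (SOME \<kappa>. \<exists>\<B>. base_of X \<B> \<and> \<kappa> = |\<B>| \<and> (\<forall>\<C>. base_of X \<C> \<longrightarrow> |\<B>| \<le>o |\<C>| ))"

lemma weight_base:
  "\<exists>\<B>. base_of X \<B> \<and> weight X = |\<B>| \<and> (\<forall>\<C>. base_of X \<C> \<longrightarrow> |\<B>| \<le>o |\<C>| )"
proof -
  define R where "R = {r. \<exists>\<B>. base_of X \<B> \<and> r = |\<B>| }"
  have "base_of X {U. openin X U}"
    unfolding base_of_def openin_topology_base_unique by blast
  then have "|{U. openin X U}| \<in> R"
    unfolding R_def by blast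
  moreover have "\<forall>r\<in>R. Card_order r"
    using card_of_Card_order unfolding R_def by blast
  ultimately obtain r where r: "r \<in> R" "\<forall>r'\<in>R. r \<le>o r'"
    using exists_minim_Card_order[of R] by blast
  then obtain \<B> where "base_of X \<B>" "r = |\<B>|"
    unfolding R_def by blast
  moreover have "|\<B>| \<le>o |\<C>|" if "base_of X \<C>" for \<C>
    using r(2) that \<open>r = |\<B>|\<close> unfolding R_def by blast
  ultimately have "\<exists>\<kappa> \<B>. base_of X \<B> \<and> \<kappa> = |\<B>| \<and> (\<forall>\<C>. base_of X \<C> \<longrightarrow> |\<B>| \<le>o |\<C>| )"
    by blast
  then show ?thesis
    unfolding weight_def by (rule someI_ex)
qed

lemma weight_ordLess_iff: "weight X <o \<kappa> \<longleftrightarrow> (\<exists>\<B>. base_of X \<B> \<and> |\<B>| <o \<kappa>)"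
proof -
  obtain \<B> where \<B>: "base_of X \<B>" "weight X = |\<B>|" "\<And>\<C>. base_of X \<C> \<Longrightarrow> |\<B>| \<le>o |\<C>|"
    using weight_base[of X] by blast
  show ?thesis
    unfolding \<B>(2) using \<B>(1,3) ordLeq_ordLess_trans by blast
qed

text \<open>
  The Cantor cube \<open>D\<^sup>\<tau>\<close>, with the field of the well-order \<open>\<tau>\<close>, which has
  cardinality \<open>\<tau>\<close>, as index set.
\<close>

definition cantor_cube :: "'i rel \<Rightarrow> ('i \<Rightarrow> nat) topology" where
  "cantor_cube \<tau> = product_topology (\<lambda>_. discrete_topology {0, 1}) (Field \<tau>)"

end

theory Submission
  imports Defs "HOL-Algebra.Free_Abelian_Groups"
begin

text \<open>
  If \<open>P\<close> has weight less than \<open>\<tau>\<close>, it has fewer than \<open>\<tau>\<close> clopen subsets, so the coordinate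
  functions restricted to \<open>P\<close> take fewer than \<open>\<tau>\<close> values and are all repetitions of those with
  index in a set \<open>J\<close> smaller than \<open>\<tau>\<close>; the same \<open>J\<close> can be taken for \<open>P\<close> and \<open>K\<close>.
  Adding modulo 2 to the remaining coordinates functions of the \<open>J\<close>-coordinates is an
  involution of the cube. Since clopen subsets of \<open>P\<close> extend to clopen subsets of the cube,
  such an involution can give the coordinates outside \<open>J\<close> arbitrary continuous values on \<open>P\<close>.
  With a disjoint copy of \<open>J\<close> among these coordinates, \<open>p \<in> P\<close> is moved to \<open>(p, f p, 0)\<close> and
  \<open>f p \<in> K\<close> to \<open>(f p, p, 0)\<close>, and these differ by an exchange of coordinates.
\<close>

section \<open>Clopen subsets of compact spaces of small weight\<close>

lemma clopen_imp_Union_base: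
  assumes "base_of X \<B>" "compact_space X" "openin X C" "closedin X C"
  obtains \<F> where "finite \<F>" "\<F> \<subseteq> \<B>" "\<Union>\<F> = C"
proof -
  have op: "openin X = arbitrary union_of (\<lambda>U. U \<in> \<B>)"
    using assms(1) by (simp add: base_of_def)
  then obtain \<U> where \<U>: "\<U> \<subseteq> \<B>" "\<Union>\<U> = C"
    using assms(3) by (auto simp: union_of_def)
  have "openin X U" if "U \<in> \<U>" for U
    using that \<U>(1) unfolding op by (intro arbitrary_union_of_inc) auto
  moreover have "compactin X C"
    using assms(2,4) by (rule closedin_compact_space)
  ultimately obtain \<F> where "finite \<F>" "\<F> \<subseteq> \<U>" "C \<subseteq> \<Union>\<F>"
    using \<U>(2) unfolding compactin_def by (metis order_refl)
  with \<U> show thesis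
    by (intro that[of \<F>]) auto
qed

text \<open>By compactness each clopen set is the union of finitely many members of a fixed base, so
  there are at most as many clopen sets as finite subsets of that base.\<close>

lemma card_of_clopen_ordLess:
  assumes "Cinfinite \<tau>" "weight X <o \<tau>" "compact_space X"
  shows "|{C. openin X C \<and> closedin X C}| <o \<tau>"
proof -
  obtain \<B> where \<B>: "base_of X \<B>" "|\<B>| <o \<tau>"
    using assms(2) weight_ordLess_iff by blast
  have "{C. openin X C \<and> closedin X C} \<subseteq> \<Union> ` Fpow \<B>"
  proof clarify
    fix C assume "openin X C" "closedin X C"
    then obtain \<F> where "finite \<F>" "\<F> \<subseteq> \<B>" "\<Union>\<F> = C"
      using clopen_imp_Union_base[OF \<B>(1) assms(3)] by metis
    then show "C \<in> \<Union> ` Fpow \<B>"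
      by (auto simp: Fpow_def)
  qed
  then have "|{C. openin X C \<and> closedin X C}| \<le>o |Fpow \<B>|"
    by (rule ordLeq_transitive[OF card_of_mono1 card_of_image])
  moreover have "|Fpow \<B>| <o \<tau>"
  \<comment> \<open>The equality of cardinals between \<open>Fpow \<B>\<close> and
    \<open>\<B>\<close> holds for infinite \<open>\<B>\<close>; a finite base has only finitely many
    subsets, fewer than the infinite \<open>\<tau>\<close>.\<close>
  proof (cases "finite \<B>")
    case True
    then have "finite (Fpow \<B>)"
      by (simp add: Fpow_Pow_finite)
    then show ?thesis
      using assms(1) by (intro Cfinite_ordLess_Cinfinite) (auto simp: cfinite_def Field_card_of)
  next
    case False
    then show ?thesis
      using \<B>(2) ordIso_ordLess_trans[OF card_of_Fpow_infinite] by blast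
  qed
  ultimately show ?thesis
    by (rule ordLeq_ordLess_trans)
qed

section \<open>Continuous maps and clopen sets of the Cantor cube\<close>

lemma topspace_cantor_cube: "topspace (cantor_cube \<tau>) = Field \<tau> \<rightarrow>\<^sub>E {0, 1}"
  by (simp add: cantor_cube_def)

lemma compact_space_cantor_cube: "compact_space (cantor_cube \<tau>)"
  by (simp add: cantor_cube_def compact_space_product_topology compact_space_discrete_topology)

lemma continuous_map_into_cantor_cube:
  assumes "\<And>i. i \<in> Field \<tau> \<Longrightarrow> continuous_map X (discrete_topology {0, 1}) (\<lambda>x. g x i)"
  shows "continuous_map X (cantor_cube \<tau>) (\<lambda>x. restrict (g x) (Field \<tau>))"
  using assms by (auto simp: cantor_cube_def continuous_map_componentwise)

lemma continuous_map_cantor_cube_coord: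
  assumes "continuous_map X (cantor_cube \<tau>) g" "i \<in> Field \<tau>"
  shows "continuous_map X (discrete_topology {0, 1}) (\<lambda>x. g x i)"
  using assms by (auto simp: cantor_cube_def continuous_map_componentwise)

lemma continuous_map_add_mod_2:
  fixes u v :: "'a \<Rightarrow> nat"
  assumes "continuous_map X (discrete_topology {0, 1}) u"
    and "continuous_map X (discrete_topology {0, 1}) v"
  shows "continuous_map X (discrete_topology {0, 1}) (\<lambda>x. (u x + v x) mod 2)"
proof -
  have "continuous_map X (discrete_topology ({0, 1} \<times> {0, 1})) (\<lambda>x. (u x, v x))"
    using assms unfolding prod_topology_discrete_topology by (simp add: continuous_map_pairedI)
  from continuous_map_compose[OF this, of "discrete_topology {0, 1}" "\<lambda>(a, b). (a + b) mod 2"]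
  show ?thesis
    by (auto simp: o_def)
qed

text \<open>A basic open box is also closed, since every subset of a discrete factor is
  closed.\<close>

lemma cantor_cube_clopen_nbhd:
  assumes "openin (cantor_cube \<tau>) W" "x \<in> W"
  obtains B where "openin (cantor_cube \<tau>) B" "closedin (cantor_cube \<tau>) B" "x \<in> B" "B \<subseteq> W"
proof -
  obtain U where U: "finite {i \<in> Field \<tau>. U i \<noteq> {0, 1}}" "\<forall>i \<in> Field \<tau>. U i \<subseteq> {0, 1}"
    "x \<in> Pi\<^sub>E (Field \<tau>) U" "Pi\<^sub>E (Field \<tau>) U \<subseteq> W"
    using assms unfolding cantor_cube_def openin_product_topology_alt
    by fastforce
  show thesis
  proof (rule that)
    show "openin (cantor_cube \<tau>) (Pi\<^sub>E (Field \<tau>) U)"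
      using U(1,2) by (simp add: cantor_cube_def openin_PiE_gen)
    show "closedin (cantor_cube \<tau>) (Pi\<^sub>E (Field \<tau>) U)"
      using U(2) by (simp add: cantor_cube_def closedin_product_topology)
  qed (use U in auto)
qed

text \<open>Each point of \<open>S\<close> has a clopen neighbourhood missing \<open>T\<close>; as
  \<open>S\<close> is compact, finitely many of these cover it, and a finite union of clopen sets is
  clopen.\<close>

lemma cantor_cube_clopen_separation:
  assumes "closedin (cantor_cube \<tau>) S" "closedin (cantor_cube \<tau>) T" "S \<inter> T = {}"
  obtains C where "openin (cantor_cube \<tau>) C" "closedin (cantor_cube \<tau>) C" "S \<subseteq> C" "C \<inter> T = {}"
proof -
  let ?X = "cantor_cube \<tau>"
  define \<U> where "\<U> = {B. openin ?X B \<and> closedin ?X B \<and> B \<inter> T = {}}"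
  have "S \<subseteq> \<Union>\<U>"
  proof
    fix x assume x: "x \<in> S"
    have "openin ?X (topspace ?X - T)" "x \<in> topspace ?X - T"
      using assms x closedin_subset by blast+
    then obtain B where "openin ?X B" "closedin ?X B" "x \<in> B" "B \<subseteq> topspace ?X - T"
      by (rule cantor_cube_clopen_nbhd)
    then show "x \<in> \<Union>\<U>"
      by (auto simp: \<U>_def)
  qed
  moreover have "compactin ?X S"
    using compact_space_cantor_cube assms(1) by (rule closedin_compact_space)
  moreover have "\<forall>U \<in> \<U>. openin ?X U"
    by (simp add: \<U>_def)
  ultimately obtain \<F> where \<F>: "finite \<F>" "\<F> \<subseteq> \<U>" "S \<subseteq> \<Union>\<F>"
    unfolding compactin_def by meson
  show thesis
  proof (rule that)
    show "openin ?X (\<Union>\<F>)" "closedin ?X (\<Union>\<F>)"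
      using \<F> by (auto simp: \<U>_def intro!: closedin_Union)
  qed (use \<F> in \<open>auto simp: \<U>_def\<close>)
qed

text \<open>The two fibres of \<open>g\<close> are closed in the cube because \<open>P\<close> is.
  The indicator function of a clopen set separating them is the extension.\<close>

lemma continuous_map_extend_cantor_cube:
  assumes P: "closedin (cantor_cube \<tau>) P"
    and g: "continuous_map (subtopology (cantor_cube \<tau>) P) (discrete_topology {0, 1}) g"
  obtains G :: "('i \<Rightarrow> nat) \<Rightarrow> nat"
  where "continuous_map (cantor_cube \<tau>) (discrete_topology {0, 1}) G" "\<And>x. x \<in> P \<Longrightarrow> G x = g x"
proof -
  let ?X = "cantor_cube \<tau>"
  have PX: "P \<subseteq> topspace ?X"
    using P closedin_subset by blast
  have cl: "closedin ?X {x \<in> P. g x = n}" if "n \<in> {0, 1}" for n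
  proof -
    have "closedin (subtopology ?X P) {x \<in> topspace (subtopology ?X P). g x \<in> {n}}"
      using g that by (intro closedin_continuous_map_preimage) auto
    moreover have "topspace (subtopology ?X P) = P"
      using PX by auto
    ultimately show ?thesis
      using P closedin_trans_full by fastforce
  qed
  obtain C where C: "openin ?X C" "closedin ?X C" "{x \<in> P. g x = 1} \<subseteq> C" "C \<inter> {x \<in> P. g x = 0} = {}"
    by (rule cantor_cube_clopen_separation[OF cl[of 1] cl[of 0]]) auto
  have g01: "g x \<in> {0, 1}" if "x \<in> P" for x
    using g that PX by (auto simp: continuous_map_def Pi_iff)
  define G where "G x = (if x \<in> C then 1 else 0 :: nat)" for x
  show thesis
  proof (rule that)
    show "continuous_map ?X (discrete_topology {0, 1}) G"
      unfolding continuous_map_def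
    proof (intro conjI allI impI)
      fix U
      have "{x \<in> topspace ?X. G x \<in> U} =
          (if 1 \<in> U then C else {}) \<union> (if 0 \<in> U then topspace ?X - C else {})"
        using openin_subset[OF C(1)] by (auto simp: G_def)
      then show "openin ?X {x \<in> topspace ?X. G x \<in> U}"
        using C(1,2) by auto
    qed (auto simp: G_def)
    show "G x = g x" if "x \<in> P" for x
      using C(3,4) g01[OF that] that by (auto simp: G_def)
  qed
qed

section \<open>Prescribing the coordinates outside \<open>J\<close> on a closed set\<close>

text \<open>The increments added outside \<open>J\<close> depend only on coordinates in
  \<open>J\<close>, which stay unchanged. A second application therefore adds the same increments
  and cancels them modulo 2.\<close>

lemma cantor_cube_shear:
  fixes P :: "('i \<Rightarrow> nat) set"
  assumes P: "closedin (cantor_cube \<tau>) P" and J: "J \<subseteq> Field \<tau>"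
    and r: "\<And>i. i \<in> Field \<tau> \<Longrightarrow> r i \<in> J" "\<And>i x. i \<in> Field \<tau> \<Longrightarrow> x \<in> P \<Longrightarrow> x (r i) = x i"
    and g: "\<And>i. i \<in> Field \<tau> \<Longrightarrow>
      continuous_map (subtopology (cantor_cube \<tau>) P) (discrete_topology {0, 1}) (\<lambda>x. g x i)"
  obtains S where "homeomorphic_map (cantor_cube \<tau>) (cantor_cube \<tau>) S"
    "\<And>x. x \<in> P \<Longrightarrow> S x = (\<lambda>i\<in>Field \<tau>. if i \<in> J then x i else g x i)"
proof -
  let ?X = "cantor_cube \<tau>"
  have PX: "P \<subseteq> topspace ?X"
    using P closedin_subset by blast
  have coord: "continuous_map ?X (discrete_topology {0, 1}) (\<lambda>x. x i)" if "i \<in> Field \<tau>" for i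
    using continuous_map_cantor_cube_coord[OF continuous_map_id that] by simp
  \<comment> \<open>The increment on \<open>P\<close> is the sum of the present value
    \<open>x i\<close> and the desired value \<open>g x i\<close>: added to \<open>x i\<close>
    modulo 2, it leaves \<open>g x i\<close>.\<close>
  have "\<exists>G. continuous_map ?X (discrete_topology {0, 1}) G \<and> (\<forall>x\<in>P. G x = (x i + g x i) mod 2)"
    if "i \<in> Field \<tau>" for i
  proof -
    have "continuous_map (subtopology ?X P) (discrete_topology {0, 1}) (\<lambda>x. (x i + g x i) mod 2)"
      by (rule continuous_map_add_mod_2[OF continuous_map_from_subtopology[OF coord[OF that]] g[OF that]])
    from continuous_map_extend_cantor_cube[OF P this] show ?thesis
      by metis
  qed
  then obtain \<Phi> where \<Phi>: "\<And>i. i \<in> Field \<tau> \<Longrightarrow> continuous_map ?X (discrete_topology {0, 1}) (\<Phi> i)"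
    "\<And>i x. i \<in> Field \<tau> \<Longrightarrow> x \<in> P \<Longrightarrow> \<Phi> i x = (x i + g x i) mod 2"
    by metis
  \<comment> \<open>\<open>\<rho>\<close> sees only the coordinates in \<open>J\<close> and fixes \<open>P\<close> pointwise.\<close>
  define \<rho> where "\<rho> x = (\<lambda>i\<in>Field \<tau>. x (r i))" for x :: "'i \<Rightarrow> nat"
  define S where "S x = (\<lambda>i\<in>Field \<tau>. if i \<in> J then x i else (x i + \<Phi> i (\<rho> x)) mod 2)" for x
  have \<rho>: "continuous_map ?X ?X \<rho>"
    unfolding \<rho>_def using r(1) J by (intro continuous_map_into_cantor_cube coord) auto
  have \<rho>P: "\<rho> x = x" if "x \<in> P" for x
    using that PX r(2) by (fastforce simp: \<rho>_def topspace_cantor_cube PiE_def extensional_def)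
  show thesis
  proof (rule that)
    show "homeomorphic_map ?X ?X S"
    proof (rule homeomorphic_map_involution)
      show "continuous_map ?X ?X S"
        unfolding S_def
      proof (rule continuous_map_into_cantor_cube)
        fix i assume i: "i \<in> Field \<tau>"
        have "continuous_map ?X (discrete_topology {0, 1}) (\<lambda>x. \<Phi> i (\<rho> x))"
          using continuous_map_compose[OF \<rho> \<Phi>(1)[OF i]] by (simp add: o_def)
        then show "continuous_map ?X (discrete_topology {0, 1})
            (\<lambda>x. if i \<in> J then x i else (x i + \<Phi> i (\<rho> x)) mod 2)"
          using coord[OF i] continuous_map_add_mod_2[OF coord[OF i]] by (cases "i \<in> J") simp_all
      qed
      fix x assume x: "x \<in> topspace ?X"
      have \<rho>S: "\<rho> (S x) = \<rho> x"
        unfolding \<rho>_def S_def using r(1) J by (auto simp: fun_eq_iff)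
      have x01: "x i = 0 \<or> x i = 1" if "i \<in> Field \<tau>" for i
        using x that by (auto simp: topspace_cantor_cube)
      have "((x i + a) mod 2 + a) mod 2 = x i" if "i \<in> Field \<tau>" for i a
        using x01[OF that] by (auto; presburger)
      then show "S (S x) = x"
        using x unfolding S_def[of "S x"] \<rho>S
        by (auto simp: S_def fun_eq_iff topspace_cantor_cube PiE_def extensional_def)
    qed
    fix x assume x: "x \<in> P"
    have "(x i + (x i + g x i) mod 2) mod 2 = g x i" if "i \<in> Field \<tau>" for i
    proof -
      have "g x i \<in> {0, 1}"
        using g[OF that] x PX by (auto simp: continuous_map_def Pi_iff)
      then show ?thesis
        by (auto; presburger)
    qed
    then show "S x = (\<lambda>i\<in>Field \<tau>. if i \<in> J then x i else g x i)"
      using x unfolding S_def \<rho>P[OF x] by (auto simp: fun_eq_iff \<Phi>(2))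
  qed
qed

section \<open>Index sets smaller than \<open>\<tau>\<close>\<close>

text \<open>A coordinate function on \<open>P\<close> is determined by the clopen set where it
  equals 1. There are fewer than \<open>\<tau>\<close> such sets, and \<open>r\<close> replaces each
  index by a chosen representative with the same set.\<close>

lemma small_weight_repeated_coords:
  assumes \<tau>: "Cinfinite \<tau>" and P: "closedin (cantor_cube \<tau>) P"
    and w: "weight (subtopology (cantor_cube \<tau>) P) <o \<tau>"
  obtains r where "r ` Field \<tau> \<subseteq> Field \<tau>" "|r ` Field \<tau>| <o \<tau>"
    "\<And>i x. i \<in> Field \<tau> \<Longrightarrow> x \<in> P \<Longrightarrow> x (r i) = x i"
proof -
  let ?X = "cantor_cube \<tau>" and ?I = "Field \<tau>"
  let ?Y = "subtopology ?X P"
  define c where "c i = {x \<in> P. x i = 1}" for i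
  define r where "r i = inv_into ?I c (c i)" for i
  have PX: "P \<subseteq> topspace ?X"
    using P closedin_subset by blast
  have tY: "topspace ?Y = P"
    using PX by auto
  have "openin ?Y (c i) \<and> closedin ?Y (c i)" if "i \<in> ?I" for i
  proof -
    have ct: "continuous_map ?Y (discrete_topology {0, 1}) (\<lambda>x. x i)"
      using continuous_map_cantor_cube_coord[OF continuous_map_id that]
      by (simp add: continuous_map_from_subtopology)
    have "c i = {x \<in> topspace ?Y. x i \<in> {1}}"
      unfolding tY c_def by auto
    then show ?thesis
      using openin_continuous_map_preimage[OF ct, of "{1}"]
        closedin_continuous_map_preimage[OF ct, of "{1}"] by auto
  qed
  then have "c ` ?I \<subseteq> {C. openin ?Y C \<and> closedin ?Y C}"
    by auto
  moreover have "compact_space ?Y"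
    using closedin_compact_space[OF compact_space_cantor_cube P] compactin_subspace by blast
  ultimately have "|c ` ?I| <o \<tau>"
    using card_of_clopen_ordLess[OF \<tau> w] card_of_mono1 ordLeq_ordLess_trans by blast
  moreover have "r ` ?I = inv_into ?I c ` (c ` ?I)"
    by (auto simp: r_def)
  ultimately have "|r ` ?I| <o \<tau>"
    using card_of_image ordLeq_ordLess_trans by metis
  moreover have rI: "r i \<in> ?I" "c (r i) = c i" if "i \<in> ?I" for i
    using that by (auto simp: r_def inv_into_into f_inv_into_f)
  moreover have "x (r i) = x i" if "i \<in> ?I" "x \<in> P" for i x
  proof -
    have "x i \<in> {0, 1}" "x (r i) \<in> {0, 1}"
      using that PX rI(1) by (auto simp: topspace_cantor_cube)
    moreover have "x (r i) = 1 \<longleftrightarrow> x i = 1"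
      using rI(2)[OF that(1)] that(2) by (auto simp: c_def)
    ultimately show ?thesis
      by auto
  qed
  ultimately show thesis
    by (intro that[of r]) auto
qed

text \<open>If \<open>I - J\<close> were smaller than \<open>I\<close>, the infinite set
  \<open>I\<close> would be the union of two smaller sets. So \<open>I - J\<close> has room for a
  copy of \<open>J\<close>.\<close>

lemma card_of_ordLess_imp_inj_into_Diff:
  assumes "infinite I" "J \<subseteq> I" "|J| <o |I|"
  obtains b where "inj_on b J" "b ` J \<subseteq> I - J"
proof -
  have "\<not> |I - J| <o |I|"
    using card_of_Un_ordLess_infinite[OF assms(1,3), of "I - J"] assms(2)
    by (metis Un_Diff_cancel Un_absorb1 ordLess_irreflexive)
  then have "|J| \<le>o |I - J|"
    using assms(3) by (meson card_of_Well_order not_ordLess_iff_ordLeq ordLess_imp_ordLeq ordLeq_transitive)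
  then show thesis
    using that by (auto simp flip: card_of_ordLeq)
qed

lemma homeomorphic_map_cantor_cube_permute:
  assumes "\<And>i. i \<in> Field \<tau> \<Longrightarrow> \<sigma> i \<in> Field \<tau>" "\<And>i. i \<in> Field \<tau> \<Longrightarrow> \<sigma> (\<sigma> i) = i"
  shows "homeomorphic_map (cantor_cube \<tau>) (cantor_cube \<tau>) (\<lambda>x. \<lambda>i\<in>Field \<tau>. x (\<sigma> i))"
proof (rule homeomorphic_map_involution)
  show "continuous_map (cantor_cube \<tau>) (cantor_cube \<tau>) (\<lambda>x. \<lambda>i\<in>Field \<tau>. x (\<sigma> i))"
    using continuous_map_cantor_cube_coord[OF continuous_map_id assms(1)]
    by (intro continuous_map_into_cantor_cube) simp
qed (use assms in \<open>auto simp: topspace_cantor_cube fun_eq_iff PiE_def extensional_def\<close>)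

section \<open>Extending the homeomorphism\<close>

theorem corollary1p3:
  fixes \<tau> :: "'i rel"
    and P K :: "('i \<Rightarrow> nat) set"
    and f :: "('i \<Rightarrow> nat) \<Rightarrow> ('i \<Rightarrow> nat)"
  assumes "Cinfinite \<tau>"
    and "closedin (cantor_cube \<tau>) P"
    and "closedin (cantor_cube \<tau>) K"
    and "weight (subtopology (cantor_cube \<tau>) P) <o \<tau>"
    and "weight (subtopology (cantor_cube \<tau>) K) <o \<tau>"
    and "homeomorphic_map (subtopology (cantor_cube \<tau>) P) (subtopology (cantor_cube \<tau>) K) f"
  shows "\<exists>h. homeomorphic_map (cantor_cube \<tau>) (cantor_cube \<tau>) h \<and> (\<forall>x\<in>P. h x = f x)"
proof -
  let ?X = "cantor_cube \<tau>" and ?I = "Field \<tau>"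
  have PX: "P \<subseteq> topspace ?X" and KX: "K \<subseteq> topspace ?X"
    using assms(2,3) closedin_subset by blast+
  obtain f' where "homeomorphic_maps (subtopology ?X P) (subtopology ?X K) f f'"
    using assms(6) homeomorphic_map_maps by blast
  then have cf: "continuous_map (subtopology ?X P) ?X f" "f ` P \<subseteq> K"
    and cf': "continuous_map (subtopology ?X K) ?X f'"
    and f'f: "\<And>x. x \<in> P \<Longrightarrow> f' (f x) = x"
    using PX KX by (auto simp: homeomorphic_maps_def continuous_map_in_subtopology Int_absorb1)
  obtain r\<^sub>P where rP: "r\<^sub>P ` ?I \<subseteq> ?I" "|r\<^sub>P ` ?I| <o \<tau>" "\<And>i x. i \<in> ?I \<Longrightarrow> x \<in> P \<Longrightarrow> x (r\<^sub>P i) = x i"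
    using small_weight_repeated_coords[OF assms(1,2,4)] by metis
  obtain r\<^sub>K where rK: "r\<^sub>K ` ?I \<subseteq> ?I" "|r\<^sub>K ` ?I| <o \<tau>" "\<And>i x. i \<in> ?I \<Longrightarrow> x \<in> K \<Longrightarrow> x (r\<^sub>K i) = x i"
    using small_weight_repeated_coords[OF assms(1,3,5)] by metis
  define J where "J = r\<^sub>P ` ?I \<union> r\<^sub>K ` ?I"
  have J: "J \<subseteq> ?I"
    using rP(1) rK(1) by (auto simp: J_def)
  have rPJ: "r\<^sub>P i \<in> J" and rKJ: "r\<^sub>K i \<in> J" if "i \<in> ?I" for i
    using that by (auto simp: J_def)
  have inf: "infinite ?I" and co: "Card_order \<tau>"
    using assms(1) by (auto simp: cinfinite_def)
  have "|J| <o |?I|"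
    unfolding J_def using card_of_Un_ordLess_infinite_Field[OF inf co rP(2) rK(2)]
      card_of_Field_ordIso[OF co] ordIso_symmetric ordLess_ordIso_trans by blast
  then obtain b where b: "inj_on b J" "b ` J \<subseteq> ?I - J"
    using card_of_ordLess_imp_inj_into_Diff[OF inf J] by metis
  let ?b' = "inv_into J b"
  have b': "?b' (b i) = i" if "i \<in> J" for i
    using b(1) that by simp
  \<comment> \<open>\<open>\<sigma>\<close> exchanges \<open>J\<close> with its copy
    \<open>b\<close>
    J\<open>and fixes every other index; it is an involution because\<close>b\<open>is injective and\<close>b
    \<open>J\<close> misses \<open>J\<close>.\<close>
  define \<sigma> where "\<sigma> i = (if i \<in> J then b i else if i \<in> b ` J then ?b' i else i)" for i
  \<comment> \<open>The \<open>J\<close>-coordinates of \<open>y\<close> are written into the copy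
    \<open>b\<close> J\<open>. The default 0 makes both sheared points agree on the indices
    outside\<close>J\<open>and\<close>b \<open>J\<close>.\<close>
  define g where "g y i = (if i \<in> b ` J then y (?b' i) else 0)" for y :: "'i \<Rightarrow> nat" and i
  have g: "continuous_map Y (discrete_topology {0, 1}) (\<lambda>x. g (u x) i)"
    if "continuous_map Y ?X u" for Y :: "('i \<Rightarrow> nat) topology" and u i
  proof (cases "i \<in> b ` J")
    case True
    then have "?b' i \<in> ?I"
      using J b' by auto
    then show ?thesis
      using continuous_map_cantor_cube_coord[OF that] True by (simp add: g_def)
  qed (simp add: g_def)
  obtain S where S: "homeomorphic_map ?X ?X S"
    "\<And>x. x \<in> P \<Longrightarrow> S x = (\<lambda>i\<in>?I. if i \<in> J then x i else g (f x) i)"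
    using cantor_cube_shear[where g = "\<lambda>x. g (f x)", OF assms(2) J rPJ rP(3) g[OF cf(1)]] by blast
  obtain T where T: "homeomorphic_map ?X ?X T"
    "\<And>y. y \<in> K \<Longrightarrow> T y = (\<lambda>i\<in>?I. if i \<in> J then y i else g (f' y) i)"
    using cantor_cube_shear[where g = "\<lambda>y. g (f' y)", OF assms(3) J rKJ rK(3) g[OF cf']] by blast
  obtain T' where T': "homeomorphic_maps ?X ?X T T'"
    using T(1) homeomorphic_map_maps by blast
  let ?\<Sigma> = "\<lambda>x. \<lambda>i\<in>?I. x (\<sigma> i) :: nat"
  have \<sigma>: "\<sigma> i \<in> ?I" "\<sigma> (\<sigma> i) = i" if "i \<in> ?I" for i
    using that b(2) J b' by (auto simp: \<sigma>_def split: if_splits)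
  \<comment> \<open>\<open>S\<close> stores \<open>f x\<close> beside \<open>x\<close>, the exchange
    of coordinates turns this into the point that \<open>T\<close> makes from \<open>f x\<close>,
    and \<open>T'\<close> recovers \<open>f x\<close> from it.\<close>
  have "homeomorphic_map ?X ?X (T' \<circ> (?\<Sigma> \<circ> S))"
    using S(1) T' homeomorphic_map_cantor_cube_permute[of \<tau> \<sigma>] \<sigma>
    by (intro homeomorphic_map_compose) (auto simp: homeomorphic_maps_map)
  moreover have "(T' \<circ> (?\<Sigma> \<circ> S)) x = f x" if x: "x \<in> P" for x
  proof -
    have fx: "f x \<in> K"
      using cf(2) x by auto
    have "?\<Sigma> (S x) = T (f x)"
    proof
      fix i
      \<comment> \<open>On \<open>J\<close> the exchange reads \<open>f x\<close> from the copy. On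
        the copy it reads \<open>x\<close> from \<open>J\<close>, which agrees with
        \<open>T (f x)\<close> since \<open>f' (f x) = x\<close>.\<close>
      consider "i \<notin> ?I" | "i \<in> J" | j where "j \<in> J" "i = b j" | "i \<in> ?I" "i \<notin> J" "i \<notin> b ` J"
        by auto
      then show "?\<Sigma> (S x) i = T (f x) i"
      proof cases
        case 1
        then show ?thesis
          by (simp add: T(2)[OF fx])
      next
        case 2
        then have "i \<in> ?I" "b i \<in> ?I" "b i \<notin> J" "b i \<in> b ` J"
          using J b(2) by auto
        then show ?thesis
          using 2 by (simp add: S(2)[OF x] T(2)[OF fx] \<sigma>_def g_def b')
      next
        case 3
        then have "j \<in> ?I" "i \<in> ?I" "i \<notin> J" "i \<in> b ` J"
          using J b(2) by auto
        then show ?thesis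
          using 3 by (simp add: S(2)[OF x] T(2)[OF fx] \<sigma>_def g_def b' f'f[OF x])
      next
        case 4
        then show ?thesis
          by (simp add: S(2)[OF x] T(2)[OF fx] \<sigma>_def g_def)
      qed
    qed
    moreover have "T' (T (f x)) = f x"
      using T' fx KX by (auto simp: homeomorphic_maps_def)
    ultimately show ?thesis
      by simp
  qed
  ultimately show ?thesis
    by blast
qed

end
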